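(* Consider the linear system in the unknowns $x=(x_{ij}^k:(i,j)^k\in U^k,\ k\in K)$ $$\sum_{j\in I_i^+(U^k)}x_{ij}^k-\sum_{j\in I_i^-(U^k)}x_{ji}^k=a_i^k,\quad i\in I^k,\ k\in K,$$ $$\sum_{(i,j)\in U}\ \sum_{k\in K(i,j)}\lambda_{ij}^{kp}x_{ij}^k=\alpha_p,\quad p=1,\ldots,q,$$ $$\sum_{k\in K_0(i,j)}x_{ij}^k=z_{ij},\quad (i,j)\in U_0.$$ For each $k\in K$ let $U_T^k\subseteq U^k$ be a spanning tree of $S^k$, and let $\tilde x^k=(\tilde x^k_{ij},(i,j)^k\in U^k)$ be a solution of the first group of equations for this $k$ with $\tilde x_{\tau\rho}^k=0$ for all $(\tau,\rho)^k\in U^k\setminus U_T^k$. Let $U_C^k\subseteq U^k\setminus U_T^k$, $k\in K$, be sets with $\sum_{k\in K}|U_C^k|=q+|U_0|$, and let $U_N^k=U^k\setminus(U_T^k\cup U_C^k)$. Let $D$ be the square matrix of order $q+|U_0|$ and $\beta=(\beta_1,\ldots,\beta_{q+|U_0|})$ the vector (depending on the variables $x_{\tau\rho}^k$, $(\tau,\rho)^k\in U_N^k$, $k\in K$) defined in the context. If $D$ is non-singular, with $D^{-1}=(\nu_{l,s})$, then the general solution of the whole system is $$x_{\tau\rho}^k=\sum_{p=1}^q\nu_{t,p}\,\beta_p+\sum_{(i,j)\in U_0}\nu_{t,\,q+\xi(i,j)}\,\beta_{q+\xi(i,j)},\quad t=t(\tau,\rho)^k,\ (\tau,\rho)^k\in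 U_C^k,\ k\in K,$$ $$x_{ij}^k=\sum_{(\tau,\rho)^k\in U_N^k}x_{\tau\rho}^k\,\mathrm{sign}(i,j)^{L_{\tau\rho}^k}+\sum_{(\tau,\rho)^k\in U_C^k}x_{\tau\rho}^k\,\mathrm{sign}(i,j)^{L_{\tau\rho}^k}+\tilde x_{ij}^k,\quad (i,j)^k\in U_T^k,\ k\in K,$$ with $x_{\tau\rho}^k\in\mathbf{R}$, $(\tau,\rho)^k\in U_N^k$, $k\in K$, being independent (free) variables.
   Context: Setting. $S=(I,U)$ is a finite connected directed network ($U\subseteq I\times I$, no loops, no multiple arcs); connectedness, trees and cycles are understood ignoring orientation. $K=\{1,\ldots,|K|\}$ is a finite set of flow types. For each $k\in K$ one is given $\widetilde U^k\subseteq U$ and a node set $I^k\subseteq I$ containing the endpoints of its arcs; $U^k=\{(i,j)^k:(i,j)\in\widetilde U^k\}$ is a copy of $\widetilde U^k$ labelled by $k$, and $S^k=(I^k,U^k)$ is assumed connected. $I_i^+(U^k)=\{j\in I^k:(i,j)^k\in U^k\}$, $I_i^-(U^k)=\{j\in I^k:(j,i)^k\in U^k\}$, $K(i,j)=\{k\in K:(i,j)^k\in U^k\}$. $U_0\subseteq U$, and for $(i,j)\in U_0$, $K_0(i,j)\subseteq K(i,j)$ is a subset with $|K_0(i,j)|>1$. All $a_i^k,\lambda_{ij}^{kp},\alpha_p,z_{ij}$ are real parameters. It is assumed that $\sum_{k\in K}|I^k|+q+|U_0|<\sum_{k\in K}|U^k|$. Cycles and signs. For $(\tau,\rho)^k\in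 U^k\setminus U_T^k$, $L_{\tau\rho}^k$ is the (arc set of the) unique cycle in $(I^k,U_T^k\cup\{(\tau,\rho)^k\})$, traversed in the direction of $(\tau,\rho)^k$. For $(i,j)^k\in U^k$, $\mathrm{sign}(i,j)^{L_{\tau\rho}^k}$ is $1$ if $(i,j)^k$ lies on the cycle and its direction agrees with the traversal, $-1$ if it lies on the cycle and its direction is opposite, and $0$ if $(i,j)^k\notin L_{\tau\rho}^k$. Quantities. For $(\tau,\rho)^k\in U^k\setminus U_T^k$, $k\in K$: $$R_p(L_{\tau\rho}^k)=\sum_{(i,j)^k\in L_{\tau\rho}^k}\lambda_{ij}^{kp}\,\mathrm{sign}(i,j)^{L_{\tau\rho}^k},\quad p=1,\ldots,q;$$ for $(i,j)\in U_0$, $\delta_{ij}(L_{\tau\rho}^k)=\mathrm{sign}(i,j)^{L_{\tau\rho}^k}$ if $k\in K_0(i,j)$ and $\delta_{ij}(L_{\tau\rho}^k)=0$ if $k\notin K_0(i,j)$. Further $$A^p=\alpha_p-\sum_{k\in K}\sum_{(i,j)^k\in U_T^k}\lambda_{ij}^{kp}\tilde x_{ij}^k,\quad p=1,\ldots,q,\qquad A_{ij}=z_{ij}-\sum_{k\in K_0(i,j),\ (i,j)^k\in U_T^k}\tilde x_{ij}^k,\quad (i,j)\in U_0.$$ Numberings. $\xi$ is an arbitrary bijection from $U_0$ to $\{1,\ldots,|U_0|\}$, and $t$ is an arbitrary bijection from $U_C=\bigcup_{k\in K}U_C^k$ to $\{1,\ldots,q+|U_0|\}$, written $t(\tau,\rho)^k$.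 Matrix and vector. $D$ has, in column $t(\tau,\rho)^k$ for $(\tau,\rho)^k\in U_C^k$, the entry $R_p(L_{\tau\rho}^k)$ in row $p$ ($p=1,\ldots,q$) and the entry $\delta_{ij}(L_{\tau\rho}^k)$ in row $q+\xi(i,j)$ ($(i,j)\in U_0$). The vector $\beta$ has components $$\beta_p=A^p-\sum_{k\in K}\sum_{(\tau,\rho)^k\in U_N^k}R_p(L_{\tau\rho}^k)x_{\tau\rho}^k,\quad p=1,\ldots,q,$$ $$\beta_{q+\xi(i,j)}=A_{ij}-\sum_{k\in K}\sum_{(\tau,\rho)^k\in U_N^k}\delta_{ij}(L_{\tau\rho}^k)x_{\tau\rho}^k,\quad (i,j)\in U_0.$$ *)

theory Defs
  imports
    Complex_Main
    "HOL-Library.FuncSet"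
    "Graph_Theory.Digraph_Component"
    "Jordan_Normal_Form.Determinant"
begin

section \<open>Cycles and spanning trees, ignoring orientation\<close>

text \<open>
  The library's \<^const>\<open>Digraph_Component.connected\<close> ignores orientation, but its
  \<^const>\<open>pre_digraph.cycle\<close> (hence also \<^const>\<open>forest\<close> and \<^const>\<open>spanning_tree\<close>) refers to
  directed cycles. We therefore walk in the digraph in which every arc \<open>e\<close> may be used
  forwards, as \<open>(e, True)\<close>, or backwards, as \<open>(e, False)\<close>. Requiring the underlying arcs to be
  distinct excludes going back and forth along one arc, while a pair of opposite arcs
  \<open>(i, j)\<close>, \<open>(j, i)\<close> does form a cycle.
\<close>

definition two_way :: "('a, 'b) pre_digraph \<Rightarrow> ('a, 'b \<times> bool) pre_digraph" where
  "two_way G = \<lparr> verts = verts G, arcs = arcs G \<times> UNIV,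
     tail = (\<lambda>(e, fwd). if fwd then tail G e else head G e),
     head = (\<lambda>(e, fwd). if fwd then head G e else tail G e) \<rparr>"

definition und_cycle :: "('a, 'b) pre_digraph \<Rightarrow> ('b \<times> bool) list \<Rightarrow> bool" where
  "und_cycle G c \<longleftrightarrow> pre_digraph.cycle (two_way G) c \<and> distinct (map fst c)"

definition und_tree :: "('a, 'b) pre_digraph \<Rightarrow> bool" where
  "und_tree G \<longleftrightarrow> Digraph_Component.connected G \<and> (\<nexists>c. und_cycle G c)"

definition und_spanning_tree :: "('a, 'b) pre_digraph \<Rightarrow> ('a, 'b) pre_digraph \<Rightarrow> bool" where
  "und_spanning_tree H G \<longleftrightarrow> und_tree H \<and> spanning H G"


section \<open>The network and the linear system\<close>

type_synonym 'v arc = "'v \<times> 'v"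

text \<open>The labelled arc \<open>(i, j)\<^sup>k\<close> is \<open>((i, j), k)\<close>.\<close>

type_synonym 'v larc = "'v arc \<times> nat"

text \<open>
  In mathematical notation the fields are \<open>I\<close>, \<open>U\<close>, \<open>|K|\<close>, \<open>I\<^sup>k\<close>, \<open>U\<close>-tilde\<open>\<^sup>k\<close>, \<open>U\<^sub>0\<close>, \<open>K\<^sub>0(i, j)\<close>, \<open>q\<close>,
  \<open>a\<^sub>i\<^sup>k\<close> (as \<open>supplies N k i\<close>), \<open>\<lambda>\<^sub>i\<^sub>j\<^sup>k\<^sup>p\<close> (as \<open>lam N p ((i, j), k)\<close>), \<open>\<alpha>\<^sub>p\<close> and \<open>z\<^sub>i\<^sub>j\<close>.
\<close>

record 'v flow_data =
  nodes :: "'v set"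
  net_arcs :: "'v arc set"
  num_types :: nat
  type_nodes :: "nat \<Rightarrow> 'v set"
  type_arcs :: "nat \<Rightarrow> 'v arc set"
  side_arcs :: "'v arc set"
  side_types :: "'v arc \<Rightarrow> nat set"
  num_side :: nat
  supplies :: "nat \<Rightarrow> 'v \<Rightarrow> real"
  lam :: "nat \<Rightarrow> 'v larc \<Rightarrow> real"
  alph :: "nat \<Rightarrow> real"
  zval :: "'v arc \<Rightarrow> real"

definition flow_types :: "'v flow_data \<Rightarrow> nat set" where
  "flow_types N = {1..num_types N}"

definition network :: "'v flow_data \<Rightarrow> ('v, 'v arc) pre_digraph" where
  "network N = \<lparr> verts = nodes N, arcs = net_arcs N, tail = fst, head = snd \<rparr>"

definition larcs :: "'v flow_data \<Rightarrow> nat \<Rightarrow> 'v larc set" where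
  "larcs N k = type_arcs N k \<times> {k}"

definition all_larcs :: "'v flow_data \<Rightarrow> 'v larc set" where
  "all_larcs N = (\<Union>k\<in>flow_types N. larcs N k)"

text \<open>\<open>type_graph N k A\<close> is \<open>(I\<^sup>k, A)\<close> for a set \<open>A\<close> of labelled arcs; in particular
  \<open>type_graph N k (larcs N k)\<close> is \<open>S\<^sup>k\<close>.\<close>

definition type_graph :: "'v flow_data \<Rightarrow> nat \<Rightarrow> 'v larc set \<Rightarrow> ('v, 'v larc) pre_digraph" where
  "type_graph N k A =
     \<lparr> verts = type_nodes N k, arcs = A, tail = (\<lambda>e. fst (fst e)), head = (\<lambda>e. snd (fst e)) \<rparr>"

definition succ_nodes :: "'v flow_data \<Rightarrow> nat \<Rightarrow> 'v \<Rightarrow> 'v set" where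
  "succ_nodes N k i = {j \<in> type_nodes N k. ((i, j), k) \<in> larcs N k}"

definition pred_nodes :: "'v flow_data \<Rightarrow> nat \<Rightarrow> 'v \<Rightarrow> 'v set" where
  "pred_nodes N k i = {j \<in> type_nodes N k. ((j, i), k) \<in> larcs N k}"

definition arc_types :: "'v flow_data \<Rightarrow> 'v arc \<Rightarrow> nat set" where
  "arc_types N e = {k \<in> flow_types N. (e, k) \<in> larcs N k}"

definition flow_network :: "'v flow_data \<Rightarrow> bool" where
  "flow_network N \<longleftrightarrow>
     digraph (network N) \<and> Digraph_Component.connected (network N) \<and>
     (\<forall>k\<in>flow_types N.
        type_arcs N k \<subseteq> net_arcs N \<and> type_nodes N k \<subseteq> nodes N \<and>
        type_arcs N k \<subseteq> type_nodes N k \<times> type_nodes N k \<and>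
        Digraph_Component.connected (type_graph N k (larcs N k))) \<and>
     side_arcs N \<subseteq> net_arcs N \<and>
     (\<forall>e\<in>side_arcs N. side_types N e \<subseteq> arc_types N e \<and> card (side_types N e) > 1) \<and>
     (\<Sum>k\<in>flow_types N. card (type_nodes N k)) + num_side N + card (side_arcs N)
       < (\<Sum>k\<in>flow_types N. card (larcs N k))"

definition balance :: "'v flow_data \<Rightarrow> nat \<Rightarrow> ('v larc \<Rightarrow> real) \<Rightarrow> bool" where
  "balance N k x \<longleftrightarrow> (\<forall>i\<in>type_nodes N k.
     (\<Sum>j\<in>succ_nodes N k i. x ((i, j), k)) - (\<Sum>j\<in>pred_nodes N k i. x ((j, i), k)) = supplies N k i)"

definition solves_system :: "'v flow_data \<Rightarrow> ('v larc \<Rightarrow> real) \<Rightarrow> bool" where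
  "solves_system N x \<longleftrightarrow>
     (\<forall>k\<in>flow_types N. balance N k x) \<and>
     (\<forall>p\<in>{1..num_side N}.
        (\<Sum>e\<in>net_arcs N. \<Sum>k\<in>arc_types N e. lam N p (e, k) * x (e, k)) = alph N p) \<and>
     (\<forall>e\<in>side_arcs N. (\<Sum>k\<in>side_types N e. x (e, k)) = zval N e)"


section \<open>Fundamental cycles, the matrix \<open>D\<close> and the vector \<open>\<beta>\<close>\<close>

text \<open>
  \<open>T k\<close> and \<open>C k\<close> stand for \<open>U\<^sub>T\<^sup>k\<close> and \<open>U\<^sub>C\<^sup>k\<close>, and \<open>xt\<close> for the partial solutions \<open>x\<close>-tilde\<open>\<^sup>k\<close>.
  The cycle \<open>L\<close> of a labelled arc \<open>e\<close> outside its tree is listed starting with \<open>e\<close> traversed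
  forwards, which makes the list unique.
\<close>

definition nonbasic :: "'v flow_data \<Rightarrow> (nat \<Rightarrow> 'v larc set) \<Rightarrow> (nat \<Rightarrow> 'v larc set) \<Rightarrow> nat \<Rightarrow> 'v larc set"
  where "nonbasic N T C k = larcs N k - (T k \<union> C k)"

definition fund_cycle :: "'v flow_data \<Rightarrow> (nat \<Rightarrow> 'v larc set) \<Rightarrow> 'v larc \<Rightarrow> ('v larc \<times> bool) list" where
  "fund_cycle N T e =
     (THE c. und_cycle (type_graph N (snd e) (T (snd e) \<union> {e})) c \<and> hd c = (e, True))"

definition cycle_arcs :: "'v flow_data \<Rightarrow> (nat \<Rightarrow> 'v larc set) \<Rightarrow> 'v larc \<Rightarrow> 'v larc set" where
  "cycle_arcs N T e = fst ` set (fund_cycle N T e)"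

text \<open>\<open>cycle_sign N T e f\<close> is the sign of \<open>f\<close> with respect to the cycle of \<open>e\<close>.\<close>

definition cycle_sign :: "'v flow_data \<Rightarrow> (nat \<Rightarrow> 'v larc set) \<Rightarrow> 'v larc \<Rightarrow> 'v larc \<Rightarrow> real" where
  "cycle_sign N T e f =
     (if (f, True) \<in> set (fund_cycle N T e) then 1
      else if (f, False) \<in> set (fund_cycle N T e) then - 1
      else 0)"

definition Rnum :: "'v flow_data \<Rightarrow> (nat \<Rightarrow> 'v larc set) \<Rightarrow> nat \<Rightarrow> 'v larc \<Rightarrow> real" where
  "Rnum N T p e = (\<Sum>f\<in>cycle_arcs N T e. lam N p f * cycle_sign N T e f)"

definition dnum :: "'v flow_data \<Rightarrow> (nat \<Rightarrow> 'v larc set) \<Rightarrow> 'v arc \<Rightarrow> 'v larc \<Rightarrow> real" where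
  "dnum N T ij e =
     (if snd e \<in> side_types N ij then cycle_sign N T e (ij, snd e) else 0)"

definition A_side ::
  "'v flow_data \<Rightarrow> (nat \<Rightarrow> 'v larc set) \<Rightarrow> ('v larc \<Rightarrow> real) \<Rightarrow> nat \<Rightarrow> real" where
  "A_side N T xt p = alph N p - (\<Sum>k\<in>flow_types N. \<Sum>e\<in>T k. lam N p e * xt e)"

definition A_arc ::
  "'v flow_data \<Rightarrow> (nat \<Rightarrow> 'v larc set) \<Rightarrow> ('v larc \<Rightarrow> real) \<Rightarrow> 'v arc \<Rightarrow> real" where
  "A_arc N T xt ij = zval N ij - (\<Sum>k\<in>{k \<in> side_types N ij. (ij, k) \<in> T k}. xt (ij, k))"

definition order_D :: "'v flow_data \<Rightarrow> nat" where
  "order_D N = num_side N + card (side_arcs N)"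

definition cyc_larcs :: "'v flow_data \<Rightarrow> (nat \<Rightarrow> 'v larc set) \<Rightarrow> 'v larc set" where
  "cyc_larcs N C = (\<Union>k\<in>flow_types N. C k)"

text \<open>
  The numberings \<open>xi\<close> and \<open>t\<close> start at 1, as do \<open>p\<close> and the components of \<open>\<beta>\<close>, whereas matrix
  indices start at 0: row \<open>l\<close> and column \<open>s\<close> of \<open>D\<close> are at position \<open>(l - 1, s - 1)\<close>.
\<close>

definition D_mat ::
  "'v flow_data \<Rightarrow> (nat \<Rightarrow> 'v larc set) \<Rightarrow> (nat \<Rightarrow> 'v larc set) \<Rightarrow> ('v arc \<Rightarrow> nat) \<Rightarrow>
     ('v larc \<Rightarrow> nat) \<Rightarrow> real mat" where
  "D_mat N T C xi t = mat (order_D N) (order_D N) (\<lambda>(r, c).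
     let l = Suc r; e = inv_into (cyc_larcs N C) t (Suc c) in
     if l \<le> num_side N then Rnum N T l e
     else dnum N T (inv_into (side_arcs N) xi (l - num_side N)) e)"

definition beta ::
  "'v flow_data \<Rightarrow> (nat \<Rightarrow> 'v larc set) \<Rightarrow> (nat \<Rightarrow> 'v larc set) \<Rightarrow> ('v larc \<Rightarrow> real) \<Rightarrow>
     ('v arc \<Rightarrow> nat) \<Rightarrow> ('v larc \<Rightarrow> real) \<Rightarrow> nat \<Rightarrow> real" where
  "beta N T C xt xi x l =
     (if l \<le> num_side N
      then A_side N T xt l
        - (\<Sum>k\<in>flow_types N. \<Sum>e\<in>nonbasic N T C k. Rnum N T l e * x e)
      else let ij = inv_into (side_arcs N) xi (l - num_side N) in
        A_arc N T xt ij
        - (\<Sum>k\<in>flow_types N. \<Sum>e\<in>nonbasic N T C k. dnum N T ij e * x e))"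

end

theory Submission
  imports Defs
begin

text \<open>
  The sign vectors of the fundamental cycles are circulations, and a circulation vanishing off a
  tree is zero. So for each flow type the balance equations say exactly that \<open>x - xt\<close> is the
  combination of fundamental cycles with the off-tree values of \<open>x\<close> as coefficients. Inserting this
  expansion into the coupling constraints leaves the square system \<open>D x\<^sub>C = \<beta>\<close>, where \<open>\<beta>\<close> depends
  only on the values of \<open>x\<close> on \<open>U\<^sub>N\<close>.
\<close>

section \<open>Circulations and fundamental cycles\<close>

text \<open>\<open>fund_cycle\<close> is a definite description of a list, so its signs are
  inaccessible until unique existence is proved. Uniqueness rests on the same vanishing principle
  that later recovers the tree variables: the sign vectors of two cycles through \<open>e\<close>
  differ by a circulation that is zero at \<open>e\<close> and hence lives on the tree. Passing from
  signs back to lists is a separate combinatorial step. The formulas of the theorem look recursive,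
  since \<open>beta\<close> and the tree sums mention \<open>x\<close> itself. The description of
  the solutions is therefore an equivalence for a given \<open>x\<close>, and the freedom of the
  variables on \<open>nonbasic\<close> is a second claim, settled by building the solution with
  prescribed values there. It is unique only as an extensional function, because the system sees
  \<open>x\<close> on \<open>all_larcs\<close> alone.\<close>

lemma two_way_simps [simp]:
  "verts (two_way G) = verts G"
  "arcs (two_way G) = arcs G \<times> UNIV"
  "tail (two_way G) (e, b) = (if b then tail G e else head G e)"
  "head (two_way G) (e, b) = (if b then head G e else tail G e)"
  by (simp_all add: two_way_def)

lemma wf_two_way:
  assumes "wf_digraph G"
  shows "wf_digraph (two_way G)"
proof -
  interpret wf_digraph G by fact
  show ?thesis by unfold_locales (auto split: if_splits)
qed

text \<open>Connectivity is reachability in \<open>mk_symmetric G\<close>. That digraph has other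
  arcs than \<open>two_way G\<close>, but the same vertices and the same adjacency relation, and
  reachability depends on nothing else.\<close>

lemma connected_imp_two_way_reachable:
  assumes "Digraph_Component.connected G" "u \<in> verts G" "v \<in> verts G"
  shows "u \<rightarrow>\<^sup>*\<^bsub>two_way G\<^esub> v"
proof -
  have "arc_to_ends (two_way G) ` (arcs G \<times> UNIV)
      = (\<Union>e\<in>arcs G. {(tail G e, head G e), (head G e, tail G e)})"
    by (simp add: arc_to_ends_def image_UN UNIV_bool Sigma_def)
  then have "arcs_ends (mk_symmetric G) = arcs_ends (two_way G)"
    by (simp add: mk_symmetric_def arcs_ends_def arc_to_ends_def)
  then show ?thesis
    using assms by (auto simp: connected_def strongly_connected_def reachable_def mk_symmetric_def)
qed

section \<open>Sign vectors of closed walks\<close>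

definition incidence :: "('a, 'b) pre_digraph \<Rightarrow> 'a \<Rightarrow> 'b \<Rightarrow> real" where
  "incidence G i e = of_bool (tail G e = i) - of_bool (head G e = i)"

definition orientation :: "bool \<Rightarrow> real" where
  "orientation b = (if b then 1 else - 1)"

text \<open>Defined for arbitrary lists, so that competing cycles can be compared before
  \<open>fund_cycle\<close> is known to be a cycle.\<close>

definition walk_sign :: "('b \<times> bool) list \<Rightarrow> 'b \<Rightarrow> real" where
  "walk_sign c f = (if (f, True) \<in> set c then 1 else if (f, False) \<in> set c then - 1 else 0)"

lemma walk_sign_eq_0: "f \<notin> fst ` set c \<Longrightarrow> walk_sign c f = 0"
  by (force simp: walk_sign_def)

text \<open>With distinct underlying arcs no arc occurs both forwards and backwards, so the signs
  lose no information: they evaluate sums along a cycle and also determine its set of steps.\<close>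

lemma walk_sign_eq_orientation:
  assumes "distinct (map fst c)"
  shows "(f, b) \<in> set c \<longleftrightarrow> walk_sign c f = orientation b"
proof -
  have "\<not> ((f, True) \<in> set c \<and> (f, False) \<in> set c)"
    using eq_key_imp_eq_value[OF assms] by blast
  then show ?thesis by (cases b) (auto simp: walk_sign_def orientation_def)
qed

text \<open>The sum telescopes: a step from \<open>v\<close> to \<open>w\<close> contributes the
  indicator of \<open>v = i\<close> minus that of \<open>w = i\<close>, whichever way its arc is
  traversed.\<close>

lemma sum_incidence_walk:
  assumes "pre_digraph.cas (two_way G) u p v"
  shows "(\<Sum>(f, b)\<leftarrow>p. orientation b * incidence G i f) = of_bool (u = i) - of_bool (v = i)"
  using assms
proof (induction p arbitrary: u)
  case Nil
  then show ?case by (simp add: pre_digraph.cas.simps)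
next
  case (Cons a p)
  then show ?case
    by (cases a) (auto simp: pre_digraph.cas.simps incidence_def orientation_def split: if_splits)
qed

lemma und_cycle_circulation:
  assumes "und_cycle G c" "finite (arcs G)"
  shows "(\<Sum>f\<in>arcs G. incidence G i f * walk_sign c f) = 0"
proof -
  obtain u where u: "pre_digraph.awalk (two_way G) u c u" and d: "distinct (map fst c)"
    using assms by (auto simp: und_cycle_def pre_digraph.cycle_def)
  have sub: "fst ` set c \<subseteq> arcs G" and cas: "pre_digraph.cas (two_way G) u c u"
    using u by (auto simp: pre_digraph.awalk_def)
  have inj: "inj_on fst (set c)" using d by (simp add: distinct_map)
  have "(\<Sum>f\<in>arcs G. incidence G i f * walk_sign c f)
      = (\<Sum>f\<in>fst ` set c. incidence G i f * walk_sign c f)"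
    using sub assms(2) by (intro sum.mono_neutral_right) (auto simp: walk_sign_eq_0)
  also have "\<dots> = (\<Sum>a\<in>set c. incidence G i (fst a) * walk_sign c (fst a))"
    using inj by (simp add: sum.reindex)
  also have "\<dots> = (\<Sum>(f, b)\<in>set c. orientation b * incidence G i f)"
    using walk_sign_eq_orientation[OF d] by (intro sum.cong) auto
  also have "\<dots> = (\<Sum>(f, b)\<leftarrow>c. orientation b * incidence G i f)"
    using d by (simp add: sum_list_distinct_conv_sum_set distinct_map)
  also have "\<dots> = 0"
    using sum_incidence_walk[OF cas] by simp
  finally show ?thesis .
qed

text \<open>Both traversals of an arc have the same two ends, so using the arc of the first step
  again would revisit the start of that step.\<close>

lemma apath_two_way_distinct_arcs:
  assumes "wf_digraph G" "pre_digraph.apath (two_way G) u p v"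
  shows "distinct (map fst p)"
  using assms(2)
proof (induction p arbitrary: u)
  case (Cons a p)
  interpret W: wf_digraph "two_way G" using assms(1) by (rule wf_two_way)
  obtain f b where a: "a = (f, b)" by (cases a)
  from Cons.prems have p: "W.apath (head (two_way G) a) p v"
    and not_in: "tail (two_way G) a \<notin> set (W.awalk_verts (head (two_way G) a) p)"
    by (auto simp: W.apath_Cons_iff)
  have "(f, b') \<notin> set p" for b'
  proof
    assume "(f, b') \<in> set p"
    then have "tail (two_way G) (f, b') \<in> set (W.awalk_verts (head (two_way G) a) p)"
      and "head (two_way G) (f, b') \<in> set (W.awalk_verts (head (two_way G) a) p)"
      using p by (auto simp only: W.apath_def intro: W.awalk_verts_arc1 W.awalk_verts_arc2)
    then show False using not_in a by (cases b; cases b') auto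
  qed
  then have "fst a \<notin> fst ` set p" using a by auto
  then show ?case using Cons.IH[OF p] by simp
qed simp

text \<open>\<open>cycle\<close> asks for distinctness of all vertices but the first; for a walk
  starting with \<open>e\<close> these are exactly the vertices of the path.\<close>

lemma und_cycle_closing_path:
  assumes "wf_digraph G" "e \<in> arcs G"
    and p: "pre_digraph.apath (two_way G) (head G e) p (tail G e)"
    and "e \<notin> fst ` set p"
  shows "und_cycle G ((e, True) # p)"
proof -
  interpret W: wf_digraph "two_way G" using assms(1) by (rule wf_two_way)
  have "W.awalk (tail G e) ((e, True) # p) (tail G e)"
    using p assms(2) by (simp add: W.awalk_Cons_iff W.apath_def)
  moreover have "distinct (tl (W.awalk_verts (tail G e) ((e, True) # p)))"
    using p by (simp add: W.apath_def)
  ultimately show ?thesis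
    using apath_two_way_distinct_arcs[OF assms(1) p] assms(4)
    by (auto simp: und_cycle_def W.cycle_def)
qed

lemma apath_two_way_mono:
  assumes "pre_digraph.apath (two_way H) u p v"
    and "verts H = verts G" "arcs H \<subseteq> arcs G" "tail H = tail G" "head H = head G"
  shows "pre_digraph.apath (two_way G) u p v"
proof -
  have *: "tail (two_way H) = tail (two_way G)" "head (two_way H) = head (two_way G)"
    unfolding two_way_def pre_digraph.select_convs assms(4,5) by (rule refl)+
  have "pre_digraph.cas (two_way H) w q z = pre_digraph.cas (two_way G) w q z" for w q z
    by (induction q arbitrary: w) (simp_all add: pre_digraph.cas.simps *)
  moreover have "pre_digraph.awalk_verts (two_way H) w q = pre_digraph.awalk_verts (two_way G) w q" for w q
    by (induction q arbitrary: w) (simp_all add: pre_digraph.awalk_verts.simps *)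
  ultimately show ?thesis
    using assms by (auto simp: pre_digraph.apath_def pre_digraph.awalk_def)
qed

text \<open>Deleting \<open>f\<close> from a forest separates its ends, and the excess of the component of the
  head of \<open>f\<close> is \<open>- y f\<close>.\<close>

lemma forest_circulation_eq_0:
  assumes wf: "wf_digraph G" and fin: "finite (verts G)" "finite (arcs G)"
    and forest: "\<nexists>c. und_cycle G c"
    and circ: "\<And>i. i \<in> verts G \<Longrightarrow> (\<Sum>e\<in>arcs G. incidence G i e * y e) = 0"
    and f: "f \<in> arcs G"
  shows "y f = 0"
proof -
  define H where "H = G\<lparr>arcs := arcs G - {f}\<rparr>"
  have H: "verts H = verts G" "arcs H = arcs G - {f}" "tail H = tail G" "head H = head G"
    by (simp_all add: H_def)
  interpret G: wf_digraph G by (rule wf)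
  have wfH: "wf_digraph H" by unfold_locales (auto simp: H)
  interpret W: wf_digraph "two_way H" using wfH by (rule wf_two_way)
  define S where "S = {v. head G f \<rightarrow>\<^sup>*\<^bsub>two_way H\<^esub> v}"
  have SV: "S \<subseteq> verts G"
    using W.reachable_in_verts by (auto simp: S_def H)
  then have finS: "finite S" using fin finite_subset by blast
  have hd: "head G f \<in> S"
    using f by (simp add: S_def H)
  have tl: "tail G f \<notin> S"
  proof
    assume "tail G f \<in> S"
    then obtain p where p: "W.apath (head G f) p (tail G f)"
      by (auto simp: S_def W.reachable_apath)
    then have "fst ` set p \<subseteq> arcs G - {f}"
      by (auto simp: W.apath_def W.awalk_def H)
    then have "und_cycle G ((f, True) # p)"
      using p f wf by (intro und_cycle_closing_path apath_two_way_mono[OF p]) (auto simp: H)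
    with forest show False by blast
  qed
  \<comment> \<open>Either traversal of \<open>e\<close> is available in \<open>two_way H\<close>,
    so no arc but \<open>f\<close> crosses the border of \<open>S\<close>.\<close>
  have same: "tail G e \<in> S \<longleftrightarrow> head G e \<in> S" if "e \<in> arcs G - {f}" for e
  proof -
    have "(tail G e, head G e) \<in> arcs_ends (two_way H)"
      using W.in_arcs_imp_in_arcs_ends[of "(e, True)"] that by (simp add: H)
    moreover have "(head G e, tail G e) \<in> arcs_ends (two_way H)"
      using W.in_arcs_imp_in_arcs_ends[of "(e, False)"] that by (simp add: H)
    ultimately show ?thesis by (auto simp: S_def intro: W.reachable_adj_trans)
  qed
  have "0 = (\<Sum>i\<in>S. \<Sum>e\<in>arcs G. incidence G i e * y e)"
    using circ SV by (subst sum.neutral) auto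
  also have "\<dots> = (\<Sum>e\<in>arcs G. (\<Sum>i\<in>S. incidence G i e) * y e)"
    by (subst sum.swap) (simp add: sum_distrib_right)
  also have "\<dots> = (\<Sum>e\<in>arcs G. (of_bool (tail G e \<in> S) - of_bool (head G e \<in> S)) * y e)"
    using finS by (simp add: incidence_def sum_subtractf of_bool_def)
  also have "\<dots> = (\<Sum>e\<in>{f}. (of_bool (tail G e \<in> S) - of_bool (head G e \<in> S)) * y e)"
    using fin f same by (intro sum.mono_neutral_right) auto
  also have "\<dots> = - y f" using hd tl by simp
  finally show ?thesis by simp
qed

text \<open>Distinct tails make each step forced: it is the only element of the common set that
  leaves the current vertex.\<close>

lemma cas_eqI_distinct_tails:
  assumes "pre_digraph.cas G u p v" "pre_digraph.cas G u q w" "set p = set q"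
    and "distinct (map (tail G) p)" "distinct (map (tail G) q)"
  shows "p = q"
  using assms
proof (induction p arbitrary: u q)
  case (Cons a p)
  then obtain b q' where q: "q = b # q'" by (cases q) auto
  have t: "tail G a = u" "tail G b = u"
    using Cons.prems q by (auto simp: pre_digraph.cas.simps)
  have "b \<in> set (a # p)" using Cons.prems q by auto
  then have ab: "b = a" using t Cons.prems(4) by (force simp: rev_image_eqI)
  have "p = q'"
  proof (rule Cons.IH)
    show "pre_digraph.cas G (head G a) p v" "pre_digraph.cas G (head G a) q' w"
      using Cons.prems q ab by (auto simp: pre_digraph.cas.simps)
    have "a \<notin> set p" "a \<notin> set q'" using Cons.prems q ab by auto
    then show "set p = set q'" using Cons.prems(3) q ab by (simp add: insert_ident)
  qed (use Cons.prems q in auto)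
  then show ?case using q ab by simp
qed simp

text \<open>The definition of \<open>cycle\<close> controls \<open>tl\<close> of the vertex list,
  which is the list of heads. In a closed walk the tails are the same vertices in another
  order.\<close>

lemma und_cycle_distinct_tails:
  assumes "wf_digraph G" "und_cycle G c"
  shows "distinct (map (tail (two_way G)) c)"
proof -
  interpret W: wf_digraph "two_way G" using assms(1) by (rule wf_two_way)
  obtain u where u: "W.awalk u c u" "distinct (tl (W.awalk_verts u c))" "c \<noteq> []"
    using assms by (auto simp: und_cycle_def W.cycle_def)
  have "W.awalk_verts u c = tail (two_way G) (hd c) # map (head (two_way G)) c"
    using u W.awalk_verts_conv'[of u c u] by auto
  moreover have "W.awalk_verts u c = map (tail (two_way G)) c @ [head (two_way G) (last c)]"
    using u by (simp add: W.awalk_verts_conv)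
  moreover have "tail (two_way G) (hd c) = head (two_way G) (last c)"
    using u W.awhd_if_cas[of u c u] W.awlast_if_cas[of u c u] calculation
    by (metis W.awalk_def last_snoc list.sel(1))
  \<comment> \<open>The vertex list is read once as tails followed by the last vertex and once as
    the first vertex followed by heads; the common vertex then cancels.\<close>
  ultimately have "mset (map (tail (two_way G)) c @ [head (two_way G) (last c)])
      = mset (head (two_way G) (last c) # map (head (two_way G)) c)"
    and tl: "tl (W.awalk_verts u c) = map (head (two_way G)) c"
    by (simp_all only: list.sel)
  then have "mset (map (tail (two_way G)) c) = mset (tl (W.awalk_verts u c))"
    by simp
  then show ?thesis using u(2) by (metis mset_eq_imp_distinct_iff)
qed

text \<open>A tree path from the head of \<open>e\<close> to its tail gives existence. For
  uniqueness, the steps of two candidates are compared through their signs and the order of the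
  steps through \<open>cas_eqI_distinct_tails\<close>.\<close>

lemma fundamental_cycle_ex1:
  fixes H :: "('a, 'b) pre_digraph" and e :: 'b
  defines "G \<equiv> H\<lparr>arcs := insert e (arcs H)\<rparr>"
  assumes wf: "wf_digraph H" and fin: "finite (verts H)" "finite (arcs H)"
    and tree: "und_tree H"
    and e: "e \<notin> arcs H" "tail H e \<in> verts H" "head H e \<in> verts H"
  shows "\<exists>!c. und_cycle G c \<and> hd c = (e, True)"
proof (rule ex_ex1I)
  have G: "verts G = verts H" "arcs G = insert e (arcs H)" "tail G = tail H" "head G = head H"
    by (simp_all add: G_def)
  interpret H: wf_digraph H by (rule wf)
  have wfG: "wf_digraph G" by unfold_locales (use e in \<open>auto simp: G\<close>)
  interpret W: wf_digraph "two_way H" using wf by (rule wf_two_way)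
  have "head H e \<rightarrow>\<^sup>*\<^bsub>two_way H\<^esub> tail H e"
    using tree e by (intro connected_imp_two_way_reachable) (auto simp: und_tree_def)
  then obtain p where p: "W.apath (head H e) p (tail H e)"
    by (auto simp: W.reachable_apath)
  then have "fst ` set p \<subseteq> arcs H"
    by (auto simp: W.apath_def W.awalk_def)
  moreover have "pre_digraph.apath (two_way G) (head G e) p (tail G e)"
    using apath_two_way_mono[OF p, of G] by (auto simp: G)
  ultimately have "und_cycle G ((e, True) # p)"
    using wfG e by (intro und_cycle_closing_path) (auto simp: G)
  then show "\<exists>c. und_cycle G c \<and> hd c = (e, True)" by force
  fix c d
  assume c: "und_cycle G c \<and> hd c = (e, True)" and d: "und_cycle G d \<and> hd d = (e, True)"
  have ne: "c \<noteq> []" "d \<noteq> []"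
    using c d by (auto simp: und_cycle_def pre_digraph.cycle_def)
  have dist: "distinct (map fst c)" "distinct (map fst d)"
    using c d by (auto simp: und_cycle_def)
  have sub: "fst ` set c \<subseteq> arcs G" "fst ` set d \<subseteq> arcs G"
    using c d by (auto simp: und_cycle_def pre_digraph.cycle_def pre_digraph.awalk_def)
  have eq_e: "walk_sign c e = walk_sign d e"
    using c d ne by (metis hd_in_set walk_sign_def)
  have "walk_sign c f - walk_sign d f = 0" if "f \<in> arcs H" for f
  proof (rule forest_circulation_eq_0[OF wf fin _ _ that])
    show "\<nexists>c. und_cycle H c" using tree by (simp add: und_tree_def)
    fix i
    have "(\<Sum>f\<in>arcs G. incidence G i f * (walk_sign c f - walk_sign d f)) = 0"
      using und_cycle_circulation[of G] c d fin
      by (simp add: right_diff_distrib sum_subtractf G(2))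
    \<comment> \<open>The term of \<open>e\<close> vanishes by \<open>eq_e\<close>, so the
      circulation on \<open>G\<close> is one on the tree.\<close>
    then show "(\<Sum>f\<in>arcs H. incidence H i f * (walk_sign c f - walk_sign d f)) = 0"
      using fin e eq_e by (simp add: G incidence_def)
  qed
  then have sign_eq: "walk_sign c f = walk_sign d f" for f
  proof (cases "f \<in> arcs G")
    case False
    then have "f \<notin> fst ` set c" "f \<notin> fst ` set d" using sub by blast+
    then show ?thesis by (simp add: walk_sign_eq_0)
  qed (use eq_e in \<open>auto simp: G\<close>)
  have "a \<in> set c \<longleftrightarrow> a \<in> set d" for a
    using walk_sign_eq_orientation[OF dist(1), of "fst a" "snd a"]
      walk_sign_eq_orientation[OF dist(2), of "fst a" "snd a"] sign_eq[of "fst a"] by simp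
  then have set_eq: "set c = set d" by blast
  obtain u where u: "pre_digraph.cas (two_way G) u c u"
    using c by (auto simp: und_cycle_def pre_digraph.cycle_def pre_digraph.awalk_def)
  obtain v where v: "pre_digraph.cas (two_way G) v d v"
    using d by (auto simp: und_cycle_def pre_digraph.cycle_def pre_digraph.awalk_def)
  \<comment> \<open>\<open>cycle\<close> hides its base vertex behind an existential quantifier; the
    common first step \<open>(e, True)\<close> forces both base vertices to be the tail of
    \<open>e\<close>.\<close>
  have "u = tail (two_way G) (e, True)"
    using u ne(1) c by (cases c) (auto simp: pre_digraph.cas.simps)
  moreover have "v = tail (two_way G) (e, True)"
    using v ne(2) d by (cases d) (auto simp: pre_digraph.cas.simps)
  ultimately have "u = v" by simp
  with v have "pre_digraph.cas (two_way G) u d u" by simp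
  then show "c = d"
    using u set_eq und_cycle_distinct_tails[OF wfG conjunct1[OF c]]
      und_cycle_distinct_tails[OF wfG conjunct1[OF d]] by (intro cas_eqI_distinct_tails)
qed

section \<open>The balance equations\<close>

lemma type_graph_simps [simp]:
  "verts (type_graph N k A) = type_nodes N k"
  "arcs (type_graph N k A) = A"
  "tail (type_graph N k A) e = fst (fst e)"
  "head (type_graph N k A) e = snd (fst e)"
  by (simp_all add: type_graph_def)

lemma incidence_type_graph:
  "incidence (type_graph N k A) i e = of_bool (fst (fst e) = i) - of_bool (snd (fst e) = i)"
  by (simp add: incidence_def)

lemma cycle_sign_eq_walk_sign: "cycle_sign N T e f = walk_sign (fund_cycle N T e) f"
  by (simp add: cycle_sign_def walk_sign_def)

lemma cycle_sign_eq_0: "f \<notin> cycle_arcs N T e \<Longrightarrow> cycle_sign N T e f = 0"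
  by (simp add: cycle_sign_eq_walk_sign walk_sign_eq_0 cycle_arcs_def)

locale tree_network =
  fixes N :: "'v flow_data" and T :: "nat \<Rightarrow> 'v larc set"
  assumes network: "flow_network N"
    and trees: "k \<in> flow_types N \<Longrightarrow>
      und_spanning_tree (type_graph N k (T k)) (type_graph N k (larcs N k))"
begin

lemma finite_net_arcs: "finite (net_arcs N)" and finite_nodes: "finite (nodes N)"
proof -
  interpret digraph "network N" using network by (simp add: flow_network_def)
  show "finite (net_arcs N)" "finite (nodes N)"
    using finite_arcs finite_verts by (simp_all add: network_def)
qed

context
  fixes k assumes k: "k \<in> flow_types N"
begin

lemma type_arcs_subset:
  "type_arcs N k \<subseteq> net_arcs N" "type_arcs N k \<subseteq> type_nodes N k \<times> type_nodes N k"
  "type_nodes N k \<subseteq> nodes N"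
  using network k by (auto simp: flow_network_def)

lemma finite_larcs: "finite (larcs N k)"
  using type_arcs_subset finite_net_arcs by (auto simp: larcs_def intro: finite_subset)

lemma finite_type_nodes: "finite (type_nodes N k)"
  using type_arcs_subset finite_nodes finite_subset by blast

lemma tree_subset: "T k \<subseteq> larcs N k"
  using trees[OF k] by (simp add: und_spanning_tree_def spanning_def subgraph_def)

lemma finite_tree: "finite (T k)"
  using tree_subset finite_larcs by (rule finite_subset)

lemma wf_tree: "wf_digraph (type_graph N k (T k))"
  using trees[OF k] by (simp add: und_spanning_tree_def spanning_def subgraph_def)

lemma und_tree_type_graph: "und_tree (type_graph N k (T k))"
  using trees[OF k] by (simp add: und_spanning_tree_def)

text \<open>\<open>A\<close> is left open because \<open>incidence\<close> reads only the ends of an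
  arc. The equations over \<open>larcs N k\<close> can thus be phrased with the graph of the tree,
  to which \<open>forest_circulation_eq_0\<close> applies.\<close>

lemma balance_iff_incidence:
  "balance N k x \<longleftrightarrow> (\<forall>i\<in>type_nodes N k.
     (\<Sum>e\<in>larcs N k. incidence (type_graph N k A) i e * x e) = supplies N k i)"
proof -
  have "(\<Sum>j\<in>succ_nodes N k i. x ((i, j), k)) - (\<Sum>j\<in>pred_nodes N k i. x ((j, i), k))
      = (\<Sum>e\<in>larcs N k. incidence (type_graph N k A) i e * x e)" for i
  proof -
    have "(\<Sum>j\<in>succ_nodes N k i. x ((i, j), k)) = (\<Sum>e\<in>{e \<in> larcs N k. fst (fst e) = i}. x e)"
      using type_arcs_subset
      by (intro sum.reindex_bij_witness[of _ "\<lambda>e. snd (fst e)" "\<lambda>j. ((i, j), k)"])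
        (auto simp: succ_nodes_def larcs_def)
    moreover have "(\<Sum>j\<in>pred_nodes N k i. x ((j, i), k)) = (\<Sum>e\<in>{e \<in> larcs N k. snd (fst e) = i}. x e)"
      using type_arcs_subset
      by (intro sum.reindex_bij_witness[of _ "\<lambda>e. fst (fst e)" "\<lambda>j. ((j, i), k)"])
        (auto simp: pred_nodes_def larcs_def)
    ultimately show ?thesis
      using finite_larcs
      by (simp add: incidence_type_graph left_diff_distrib sum_subtractf sum.inter_filter
          of_bool_def if_distrib[of "\<lambda>a. a * _"] cong: if_cong)
  qed
  then show ?thesis by (simp add: balance_def)
qed

lemma fund_cycle_spec:
  assumes "e \<in> larcs N k - T k"
  shows "und_cycle (type_graph N k (T k \<union> {e})) (fund_cycle N T e)"
    and "hd (fund_cycle N T e) = (e, True)"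
proof -
  have e: "snd e = k" "fst (fst e) \<in> type_nodes N k" "snd (fst e) \<in> type_nodes N k"
    using assms type_arcs_subset by (auto simp: larcs_def)
  have "(type_graph N k (T k))\<lparr>arcs := insert e (arcs (type_graph N k (T k)))\<rparr>
      = type_graph N k (T k \<union> {e})"
    by (simp add: type_graph_def)
  then have "\<exists>!c. und_cycle (type_graph N k (T k \<union> {e})) c \<and> hd c = (e, True)"
    using fundamental_cycle_ex1[OF wf_tree _ _ und_tree_type_graph, of e] assms e
      finite_type_nodes finite_tree by simp
  from theI'[OF this] show "und_cycle (type_graph N k (T k \<union> {e})) (fund_cycle N T e)"
    and "hd (fund_cycle N T e) = (e, True)"
    by (simp_all add: fund_cycle_def e)
qed

lemma cycle_arcs_subset:
  assumes "e \<in> larcs N k - T k"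
  shows "cycle_arcs N T e \<subseteq> T k \<union> {e}"
  using fund_cycle_spec(1)[OF assms]
  by (auto simp: cycle_arcs_def und_cycle_def pre_digraph.cycle_def pre_digraph.awalk_def)

lemma cycle_sign_self:
  assumes "e \<in> larcs N k - T k"
  shows "cycle_sign N T e e = 1"
proof -
  have "fund_cycle N T e \<noteq> []"
    using fund_cycle_spec(1)[OF assms] by (auto simp: und_cycle_def pre_digraph.cycle_def)
  then have "(e, True) \<in> set (fund_cycle N T e)"
    using fund_cycle_spec(2)[OF assms] hd_in_set by metis
  then show ?thesis by (simp add: cycle_sign_def)
qed

text \<open>The cycle of \<open>e\<close> leaves the tree only in \<open>e\<close>. Restricted to
  the arcs off the tree, the sign vectors therefore form an identity matrix, and a combination of
  them has its coefficients as off-tree values.\<close>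

lemma cycle_sign_off_tree:
  assumes "e \<in> larcs N k - T k" "f \<notin> T k"
  shows "cycle_sign N T e f = of_bool (e = f)"
  using cycle_sign_self[OF assms(1)] cycle_sign_eq_0[of f N T e] cycle_arcs_subset[OF assms(1)] assms(2)
  by (cases "e = f") auto

lemma cycle_sign_circulation:
  assumes "e \<in> larcs N k - T k"
  shows "(\<Sum>f\<in>larcs N k. incidence (type_graph N k A) i f * cycle_sign N T e f) = 0"
proof -
  have "(\<Sum>f\<in>larcs N k. incidence (type_graph N k A) i f * cycle_sign N T e f)
      = (\<Sum>f\<in>T k \<union> {e}. incidence (type_graph N k (T k \<union> {e})) i f * cycle_sign N T e f)"
    using assms tree_subset finite_larcs
    by (intro sum.mono_neutral_cong_right) (auto simp: cycle_sign_off_tree incidence_type_graph)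
  also have "\<dots> = 0"
    using und_cycle_circulation[OF fund_cycle_spec(1)[OF assms], of i] finite_tree
    by (simp add: cycle_sign_eq_walk_sign)
  finally show ?thesis .
qed

section \<open>Expansion in fundamental cycles\<close>

lemma Rnum_eq_sum_larcs:
  assumes "e \<in> larcs N k - T k"
  shows "Rnum N T p e = (\<Sum>f\<in>larcs N k. lam N p f * cycle_sign N T e f)"
  unfolding Rnum_def
  using cycle_arcs_subset[OF assms] tree_subset assms finite_larcs
  by (intro sum.mono_neutral_left) (auto simp: cycle_sign_eq_0)

lemma sum_cycle_sign_off_tree:
  assumes "f \<in> larcs N k - T k"
  shows "(\<Sum>e\<in>larcs N k - T k. x e * cycle_sign N T e f) = x f"
proof -
  have "(\<Sum>e\<in>larcs N k - T k. x e * cycle_sign N T e f)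
      = (\<Sum>e\<in>larcs N k - T k. if e = f then x e else 0)"
    using assms by (intro sum.cong) (auto simp: cycle_sign_off_tree)
  then show ?thesis using assms finite_larcs by simp
qed

text \<open>The function \<open>z\<close> satisfies the balance equations for every
  \<open>x\<close>, since it adds circulations to \<open>xt\<close>, and it agrees with
  \<open>x\<close> off the tree. For balanced \<open>x\<close> the difference is thus a circulation
  supported on the tree.\<close>

lemma balance_iff_cycle_expansion:
  assumes xt: "balance N k xt" "\<And>e. e \<in> larcs N k - T k \<Longrightarrow> xt e = 0"
  shows "balance N k x \<longleftrightarrow>
    (\<forall>f\<in>larcs N k. x f = (\<Sum>e\<in>larcs N k - T k. x e * cycle_sign N T e f) + xt f)"
proof -
  let ?G = "type_graph N k (T k)"
  define z where "z f = (\<Sum>e\<in>larcs N k - T k. x e * cycle_sign N T e f) + xt f" for f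
  have z: "(\<Sum>f\<in>larcs N k. incidence ?G i f * z f) = supplies N k i"
    if i: "i \<in> type_nodes N k" for i
  proof -
    have "(\<Sum>f\<in>larcs N k. incidence ?G i f * z f)
        = (\<Sum>e\<in>larcs N k - T k. x e * (\<Sum>f\<in>larcs N k. incidence ?G i f * cycle_sign N T e f))
        + (\<Sum>f\<in>larcs N k. incidence ?G i f * xt f)"
      unfolding z_def sum_distrib_left distrib_left sum.distrib
      by (subst sum.swap) (simp add: mult_ac)
    then show ?thesis
      using xt(1) i by (simp add: cycle_sign_circulation balance_iff_incidence[of _ "T k"])
  qed
  have off_tree: "z f = x f" if "f \<in> larcs N k - T k" for f
    using that xt(2) by (simp add: z_def sum_cycle_sign_off_tree)
  have "x f = z f" if bal: "balance N k x" and f: "f \<in> larcs N k" for f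
  proof (cases "f \<in> T k")
    case True
    have "x f - z f = 0"
    proof (rule forest_circulation_eq_0[OF wf_tree])
      show "\<nexists>c. und_cycle ?G c" using und_tree_type_graph by (simp add: und_tree_def)
      fix i assume "i \<in> verts ?G"
      then have "(\<Sum>f\<in>larcs N k. incidence ?G i f * (x f - z f)) = 0"
        using bal z by (simp add: right_diff_distrib sum_subtractf balance_iff_incidence[of _ "T k"])
      moreover have "(\<Sum>f\<in>larcs N k. incidence ?G i f * (x f - z f))
          = (\<Sum>f\<in>T k. incidence ?G i f * (x f - z f))"
        using tree_subset finite_larcs off_tree by (intro sum.mono_neutral_right) auto
      ultimately show "(\<Sum>f\<in>arcs ?G. incidence ?G i f * (x f - z f)) = 0" by simp
    qed (use True finite_type_nodes finite_tree in auto)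
    then show ?thesis by simp
  qed (use f off_tree in auto)
  moreover have "balance N k x" if "\<forall>f\<in>larcs N k. x f = z f"
    using that z by (simp add: balance_iff_incidence[of _ "T k"])
  ultimately show ?thesis unfolding z_def by blast
qed

text \<open>Off the tree the expansion is an identity, so only the tree equations carry
  content.\<close>

lemma tree_expansion_iff:
  assumes "\<And>e. e \<in> larcs N k - T k \<Longrightarrow> xt e = 0" and C: "C k \<subseteq> larcs N k - T k"
  shows "(\<forall>f\<in>larcs N k. x f = (\<Sum>e\<in>larcs N k - T k. x e * cycle_sign N T e f) + xt f) \<longleftrightarrow>
    (\<forall>f\<in>T k. x f = (\<Sum>e\<in>nonbasic N T C k. x e * cycle_sign N T e f)
      + (\<Sum>e\<in>C k. x e * cycle_sign N T e f) + xt f)"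
proof -
  have "larcs N k - T k = nonbasic N T C k \<union> C k" "nonbasic N T C k \<inter> C k = {}"
    "finite (nonbasic N T C k)" "finite (C k)"
    using C finite_larcs finite_subset[of "C k" "larcs N k"] by (auto simp: nonbasic_def)
  then have split: "(\<Sum>e\<in>larcs N k - T k. x e * cycle_sign N T e f)
      = (\<Sum>e\<in>nonbasic N T C k. x e * cycle_sign N T e f) + (\<Sum>e\<in>C k. x e * cycle_sign N T e f)" for f
    by (simp add: sum.union_disjoint)
  have off_tree: "x f = (\<Sum>e\<in>larcs N k - T k. x e * cycle_sign N T e f) + xt f"
    if "f \<in> larcs N k - T k" for f
    using that assms(1) by (simp add: sum_cycle_sign_off_tree)
  show ?thesis
    unfolding split[symmetric] using off_tree tree_subset by blast
qed

text \<open>A linear functional of \<open>x\<close> becomes an affine function of the off-tree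
  variables; the coefficient of \<open>x e\<close> is the value of the functional on the cycle of
  \<open>e\<close>. Both \<open>Rnum\<close> and \<open>dnum\<close> arise in this way.\<close>

lemma weighted_sum_cycle_expansion:
  assumes x: "\<forall>f\<in>larcs N k. x f = (\<Sum>e\<in>larcs N k - T k. x e * cycle_sign N T e f) + xt f"
    and xt: "\<And>e. e \<in> larcs N k - T k \<Longrightarrow> xt e = 0"
  shows "(\<Sum>f\<in>larcs N k. w f * x f)
    = (\<Sum>e\<in>larcs N k - T k. (\<Sum>f\<in>larcs N k. w f * cycle_sign N T e f) * x e)
      + (\<Sum>f\<in>T k. w f * xt f)"
proof -
  have "(\<Sum>f\<in>larcs N k. w f * x f)
      = (\<Sum>f\<in>larcs N k. w f * ((\<Sum>e\<in>larcs N k - T k. x e * cycle_sign N T e f) + xt f))"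
    using x by (intro sum.cong) auto
  also have "\<dots> = (\<Sum>e\<in>larcs N k - T k. (\<Sum>f\<in>larcs N k. w f * cycle_sign N T e f) * x e)
      + (\<Sum>f\<in>larcs N k. w f * xt f)"
    unfolding sum_distrib_left sum_distrib_right distrib_left sum.distrib
    by (subst sum.swap) (simp add: mult_ac)
  also have "(\<Sum>f\<in>larcs N k. w f * xt f) = (\<Sum>f\<in>T k. w f * xt f)"
    using tree_subset finite_larcs xt by (intro sum.mono_neutral_right) auto
  finally show ?thesis .
qed

end

end

section \<open>The coupling constraints\<close>

text \<open>The equivalence concerns a given pair \<open>u\<close>, \<open>b\<close>, so
  \<open>b\<close> may itself depend on the unknowns, as \<open>beta\<close> does.\<close>

lemma inverts_mat_solve_iff:
  fixes D E :: "'a :: comm_ring_1 mat"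
  assumes "D \<in> carrier_mat n n" "E \<in> carrier_mat n n" "inverts_mat D E" "inverts_mat E D"
  shows "(\<forall>r<n. (\<Sum>c<n. D $$ (r, c) * u c) = b r) \<longleftrightarrow> (\<forall>c<n. u c = (\<Sum>r<n. E $$ (c, r) * b r))"
proof -
  have rows: "(A *\<^sub>v vec n v = vec n w) \<longleftrightarrow> (\<forall>r<n. (\<Sum>c<n. A $$ (r, c) * v c) = w r)"
    if "A \<in> carrier_mat n n" for A :: "'a mat" and v w
    using that by (auto simp: vec_eq_iff scalar_prod_def lessThan_atLeast0)
  have "D * E = 1\<^sub>m n" "E * D = 1\<^sub>m n"
    using assms by (auto simp: inverts_mat_def)
  then have "D *\<^sub>v vec n u = vec n b \<longleftrightarrow> E *\<^sub>v vec n b = vec n u"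
    using assms(1,2) assoc_mult_mat_vec[of D n n E n "vec n b"]
      assoc_mult_mat_vec[of E n n D n "vec n u"] by auto
  then show ?thesis
    unfolding rows[OF assms(1)] rows[OF assms(2)] by (auto simp: eq_commute)
qed

text \<open>Both kinds of coupling constraint in one form: row \<open>l\<close> of the system is
  \<open>\<Sum>f. row_weight N xi l f * x f = row_rhs N xi l\<close>.\<close>

definition row_weight :: "'v flow_data \<Rightarrow> ('v arc \<Rightarrow> nat) \<Rightarrow> nat \<Rightarrow> 'v larc \<Rightarrow> real" where
  "row_weight N xi l f =
     (if l \<le> num_side N then lam N l f
      else let ij = inv_into (side_arcs N) xi (l - num_side N) in
        of_bool (fst f = ij \<and> snd f \<in> side_types N ij))"

definition row_rhs :: "'v flow_data \<Rightarrow> ('v arc \<Rightarrow> nat) \<Rightarrow> nat \<Rightarrow> real" where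
  "row_rhs N xi l =
     (if l \<le> num_side N then alph N l
      else zval N (inv_into (side_arcs N) xi (l - num_side N)))"

lemma sum_side_weight:
  assumes "A \<subseteq> larcs N k" "finite A"
  shows "(\<Sum>f\<in>A. of_bool (fst f = ij \<and> snd f \<in> side_types N ij) * g f)
    = (if k \<in> side_types N ij \<and> (ij, k) \<in> A then g (ij, k) else (0 :: real))"
proof -
  have "(\<Sum>f\<in>A. of_bool (fst f = ij \<and> snd f \<in> side_types N ij) * g f)
      = (\<Sum>f\<in>A. if f = (ij, k) then of_bool (k \<in> side_types N ij) * g (ij, k) else 0)"
    using assms by (intro sum.cong) (auto simp: larcs_def)
  then show ?thesis
    using assms(2) by simp
qed

locale cyclic_basis = tree_network N T
  for N :: "'v flow_data" and T :: "nat \<Rightarrow> 'v larc set" +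
  fixes C :: "nat \<Rightarrow> 'v larc set" and xt :: "'v larc \<Rightarrow> real"
    and xi :: "'v arc \<Rightarrow> nat" and t :: "'v larc \<Rightarrow> nat"
  assumes xt_balance: "k \<in> flow_types N \<Longrightarrow> balance N k xt"
    and xt_off_tree: "k \<in> flow_types N \<Longrightarrow> e \<in> larcs N k - T k \<Longrightarrow> xt e = 0"
    and C_subset: "k \<in> flow_types N \<Longrightarrow> C k \<subseteq> larcs N k - T k"
    and bij_xi: "bij_betw xi (side_arcs N) {1..card (side_arcs N)}"
    and bij_t: "bij_betw t (cyc_larcs N C) {1..order_D N}"
begin

text \<open>The entry of \<open>D_mat\<close> in row \<open>l\<close>, extended from the columns in
  \<open>C\<close> to every arc, because \<open>beta\<close> uses the same coefficients on
  \<open>nonbasic\<close>.\<close>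

abbreviation row_coeff :: "nat \<Rightarrow> 'v larc \<Rightarrow> real" where
  "row_coeff l e \<equiv> (if l \<le> num_side N then Rnum N T l e
      else dnum N T (inv_into (side_arcs N) xi (l - num_side N)) e)"

lemma finite_flow_types: "finite (flow_types N)"
  by (simp add: flow_types_def)

lemma side_types_subset:
  assumes "ij \<in> side_arcs N" "k \<in> side_types N ij"
  shows "k \<in> flow_types N" "(ij, k) \<in> larcs N k"
  using network assms by (force simp: flow_network_def arc_types_def)+

lemma xi_row:
  assumes "l \<in> {1..order_D N}" "\<not> l \<le> num_side N"
  shows "inv_into (side_arcs N) xi (l - num_side N) \<in> side_arcs N"
proof -
  have "l - num_side N \<in> xi ` side_arcs N"
    using assms bij_xi by (auto simp: bij_betw_def order_D_def)
  then show ?thesis by (rule inv_into_into)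
qed

lemma inv_xi: "ij \<in> side_arcs N \<Longrightarrow> inv_into (side_arcs N) xi (xi ij) = ij"
  using bij_xi by (simp add: bij_betw_def)

lemma xi_range: "ij \<in> side_arcs N \<Longrightarrow> xi ij \<in> {1..card (side_arcs N)}"
  using bij_xi by (auto simp: bij_betw_def)

lemma sum_net_arcs_eq_sum_larcs:
  "(\<Sum>e\<in>net_arcs N. \<Sum>k\<in>arc_types N e. g (e, k)) = (\<Sum>k\<in>flow_types N. \<Sum>f\<in>larcs N k. g f :: real)"
proof -
  have "(\<Sum>e\<in>net_arcs N. \<Sum>k\<in>arc_types N e. g (e, k))
      = (\<Sum>e\<in>net_arcs N. \<Sum>k\<in>flow_types N. if e \<in> type_arcs N k then g (e, k) else 0)"
    unfolding arc_types_def using finite_flow_types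
    by (simp add: larcs_def sum.inter_filter)
  also have "\<dots> = (\<Sum>k\<in>flow_types N. \<Sum>e\<in>net_arcs N. if e \<in> type_arcs N k then g (e, k) else 0)"
    by (rule sum.swap)
  also have "\<dots> = (\<Sum>k\<in>flow_types N. \<Sum>f\<in>larcs N k. g f)"
  proof (intro sum.cong refl)
    fix k assume "k \<in> flow_types N"
    from type_arcs_subset(1)[OF this]
    have "(\<Sum>e\<in>net_arcs N. if e \<in> type_arcs N k then g (e, k) else 0) = (\<Sum>e\<in>type_arcs N k. g (e, k))"
      using finite_net_arcs by (simp add: sum.inter_restrict[symmetric] Int_absorb1)
    also have "\<dots> = (\<Sum>f\<in>larcs N k. g f)"
      by (intro sum.reindex_bij_witness[of _ fst "\<lambda>e. (e, k)"]) (auto simp: larcs_def)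
    finally show "(\<Sum>e\<in>net_arcs N. if e \<in> type_arcs N k then g (e, k) else 0) = (\<Sum>f\<in>larcs N k. g f)" .
  qed
  finally show ?thesis .
qed

text \<open>The family \<open>A\<close> is general so that one identity serves the constraint
  itself, with \<open>larcs N\<close>, and the tree sum in \<open>A_arc\<close>, with
  \<open>T\<close>.\<close>

lemma sum_side_types_eq_sum_larcs:
  assumes "ij \<in> side_arcs N" and A: "\<And>k. k \<in> flow_types N \<Longrightarrow> A k \<subseteq> larcs N k"
  shows "(\<Sum>k\<in>flow_types N. \<Sum>f\<in>A k. of_bool (fst f = ij \<and> snd f \<in> side_types N ij) * g f)
    = (\<Sum>k\<in>{k \<in> side_types N ij. (ij, k) \<in> A k}. g (ij, k) :: real)"
proof -
  have "(\<Sum>k\<in>flow_types N. \<Sum>f\<in>A k. of_bool (fst f = ij \<and> snd f \<in> side_types N ij) * g f)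
      = (\<Sum>k\<in>flow_types N. if k \<in> side_types N ij \<and> (ij, k) \<in> A k then g (ij, k) else 0)"
    using A finite_larcs finite_subset by (intro sum.cong refl sum_side_weight) blast+
  also have "\<dots> = (\<Sum>k\<in>{k \<in> flow_types N. k \<in> side_types N ij \<and> (ij, k) \<in> A k}. g (ij, k))"
    using finite_flow_types by (simp add: sum.inter_filter)
  also have "{k \<in> flow_types N. k \<in> side_types N ij \<and> (ij, k) \<in> A k} = {k \<in> side_types N ij. (ij, k) \<in> A k}"
    using side_types_subset(1)[OF assms(1)] by blast
  finally show ?thesis .
qed

lemma solves_system_iff_rows:
  "solves_system N x \<longleftrightarrow> (\<forall>k\<in>flow_types N. balance N k x) \<and>
    (\<forall>l\<in>{1..order_D N}.
      (\<Sum>k\<in>flow_types N. \<Sum>f\<in>larcs N k. row_weight N xi l f * x f) = row_rhs N xi l)"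
    (is "_ \<longleftrightarrow> _ \<and> (\<forall>l\<in>_. ?row l)")
proof -
  \<comment> \<open>Surjectivity of \<open>xi\<close> allows the rows beyond
    \<open>num_side N\<close> to be indexed by the side arcs themselves.\<close>
  have range: "{1..order_D N} = {1..num_side N} \<union> (\<lambda>ij. num_side N + xi ij) ` side_arcs N"
  proof -
    have "(\<lambda>ij. num_side N + xi ij) ` side_arcs N = (+) (num_side N) ` {1..card (side_arcs N)}"
      using bij_xi by (metis bij_betw_imp_surj_on image_image)
    then show ?thesis by (auto simp: order_D_def)
  qed
  have lam_row: "?row l \<longleftrightarrow>
      (\<Sum>e\<in>net_arcs N. \<Sum>k\<in>arc_types N e. lam N l (e, k) * x (e, k)) = alph N l"
    if "l \<in> {1..num_side N}" for l
    using that sum_net_arcs_eq_sum_larcs[of "\<lambda>f. lam N l f * x f"]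
    by (simp add: row_weight_def row_rhs_def)
  have side_row: "?row (num_side N + xi ij) \<longleftrightarrow> (\<Sum>k\<in>side_types N ij. x (ij, k)) = zval N ij"
    if ij: "ij \<in> side_arcs N" for ij
  proof -
    have "{k \<in> side_types N ij. (ij, k) \<in> larcs N k} = side_types N ij"
      using side_types_subset(2)[OF ij] by blast
    then show ?thesis
      using sum_side_types_eq_sum_larcs[OF ij, of "larcs N" x] xi_range[OF ij]
      by (simp add: row_weight_def row_rhs_def inv_xi[OF ij])
  qed
  show ?thesis
    unfolding solves_system_def range ball_Un ball_simps(9) using lam_row side_row by auto
qed

text \<open>This identifies the coefficients produced by \<open>weighted_sum_cycle_expansion\<close>
  with the matrix entries. In a side row only the arc \<open>(ij, k)\<close> of the cycle can count,
  since all its arcs carry the label \<open>k\<close>.\<close>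

lemma row_coeff_eq_sum:
  assumes "l \<in> {1..order_D N}" "k \<in> flow_types N" "e \<in> larcs N k - T k"
  shows "(\<Sum>f\<in>larcs N k. row_weight N xi l f * cycle_sign N T e f) = row_coeff l e"
proof (cases "l \<le> num_side N")
  case True
  then show ?thesis
    by (simp add: row_weight_def Rnum_eq_sum_larcs[OF assms(2,3)])
next
  case False
  define ij where "ij = inv_into (side_arcs N) xi (l - num_side N)"
  have ij: "ij \<in> side_arcs N" using xi_row[OF assms(1) False] by (simp add: ij_def)
  have "snd e = k" using assms by (auto simp: larcs_def)
  then show ?thesis
    using False side_types_subset(2)[OF ij]
      sum_side_weight[OF order_refl finite_larcs[OF assms(2)], of ij "cycle_sign N T e"]
    by (auto simp: row_weight_def dnum_def ij_def[symmetric])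
qed

lemma beta_eq:
  assumes "l \<in> {1..order_D N}"
  shows "beta N T C xt xi x l = row_rhs N xi l
    - (\<Sum>k\<in>flow_types N. \<Sum>f\<in>T k. row_weight N xi l f * xt f)
    - (\<Sum>k\<in>flow_types N. \<Sum>e\<in>nonbasic N T C k. row_coeff l e * x e)"
proof (cases "l \<le> num_side N")
  case True
  then show ?thesis by (simp add: beta_def A_side_def row_rhs_def row_weight_def)
next
  case False
  show ?thesis
    using False sum_side_types_eq_sum_larcs[OF xi_row[OF assms False], of T xt] tree_subset
    by (simp add: beta_def A_arc_def row_rhs_def row_weight_def Let_def)
qed

text \<open>For \<open>x\<close> in expanded form a row splits into contributions of
  \<open>nonbasic\<close>, of \<open>C\<close>, and of \<open>xt\<close> on the tree; moving the
  first and the last to the right-hand side produces \<open>beta\<close>.\<close>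

lemma row_iff:
  assumes l: "l \<in> {1..order_D N}"
    and x: "\<forall>k\<in>flow_types N. \<forall>f\<in>larcs N k.
      x f = (\<Sum>e\<in>larcs N k - T k. x e * cycle_sign N T e f) + xt f"
  shows "(\<Sum>k\<in>flow_types N. \<Sum>f\<in>larcs N k. row_weight N xi l f * x f) = row_rhs N xi l \<longleftrightarrow>
    (\<Sum>e\<in>cyc_larcs N C. row_coeff l e * x e) = beta N T C xt xi x l"
proof -
  have "(\<Sum>k\<in>flow_types N. \<Sum>f\<in>larcs N k. row_weight N xi l f * x f)
    = (\<Sum>k\<in>flow_types N. (\<Sum>e\<in>nonbasic N T C k. row_coeff l e * x e)
        + (\<Sum>e\<in>C k. row_coeff l e * x e) + (\<Sum>f\<in>T k. row_weight N xi l f * xt f))"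
  proof (intro sum.cong refl)
    fix k assume k: "k \<in> flow_types N"
    have "(\<Sum>f\<in>larcs N k. row_weight N xi l f * x f)
        = (\<Sum>e\<in>larcs N k - T k.
            (\<Sum>f\<in>larcs N k. row_weight N xi l f * cycle_sign N T e f) * x e)
          + (\<Sum>f\<in>T k. row_weight N xi l f * xt f)"
      using k x xt_off_tree by (intro weighted_sum_cycle_expansion) auto
    also have "\<dots> = (\<Sum>e\<in>larcs N k - T k. row_coeff l e * x e)
          + (\<Sum>f\<in>T k. row_weight N xi l f * xt f)"
      using row_coeff_eq_sum[OF l k] by simp
    also have "larcs N k - T k = nonbasic N T C k \<union> C k"
      using C_subset[OF k] by (auto simp: nonbasic_def)
    also have "(\<Sum>e\<in>nonbasic N T C k \<union> C k. row_coeff l e * x e)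
        = (\<Sum>e\<in>nonbasic N T C k. row_coeff l e * x e) + (\<Sum>e\<in>C k. row_coeff l e * x e)"
      using finite_larcs[OF k] C_subset[OF k] finite_subset[of "C k" "larcs N k"]
      by (intro sum.union_disjoint) (auto simp: nonbasic_def)
    finally show "(\<Sum>f\<in>larcs N k. row_weight N xi l f * x f)
      = (\<Sum>e\<in>nonbasic N T C k. row_coeff l e * x e)
        + (\<Sum>e\<in>C k. row_coeff l e * x e) + (\<Sum>f\<in>T k. row_weight N xi l f * xt f)" .
  qed
  moreover have "(\<Sum>e\<in>cyc_larcs N C. row_coeff l e * x e)
      = (\<Sum>k\<in>flow_types N. \<Sum>e\<in>C k. row_coeff l e * x e)"
    unfolding cyc_larcs_def
  proof (rule sum.UNION_disjoint)
    show "\<forall>k\<in>flow_types N. finite (C k)"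
      using finite_larcs C_subset by (meson Diff_subset finite_subset subset_trans)
    show "\<forall>k\<in>flow_types N. \<forall>j\<in>flow_types N. k \<noteq> j \<longrightarrow> C k \<inter> C j = {}"
    proof (intro ballI impI)
      fix k j assume "k \<in> flow_types N" "j \<in> flow_types N" "k \<noteq> j"
      then show "C k \<inter> C j = {}"
        using C_subset[of k] C_subset[of j] by (auto simp: larcs_def)
    qed
  qed (rule finite_flow_types)
  ultimately show ?thesis
    unfolding beta_eq[OF l] sum.distrib by linarith
qed

section \<open>Solving the square system for the variables on \<open>C\<close>\<close>

lemma sum_cyc_larcs_eq_D_mat_row:
  assumes "r < order_D N"
  shows "(\<Sum>e\<in>cyc_larcs N C. row_coeff (Suc r) e * x e)
    = (\<Sum>c<order_D N. D_mat N T C xi t $$ (r, c) * x (inv_into (cyc_larcs N C) t (Suc c)))"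
proof -
  have "(\<Sum>e\<in>cyc_larcs N C. row_coeff (Suc r) e * x e)
      = (\<Sum>s=1..order_D N. row_coeff (Suc r) (inv_into (cyc_larcs N C) t s)
          * x (inv_into (cyc_larcs N C) t s))"
    by (rule sum.reindex_bij_betw[OF bij_betw_inv_into[OF bij_t], symmetric])
  \<comment> \<open>Shift from the numbering by \<open>t\<close>, which starts at 1, to matrix
    columns, which start at 0.\<close>
  also have "\<dots> = (\<Sum>c<order_D N. row_coeff (Suc r) (inv_into (cyc_larcs N C) t (Suc c))
          * x (inv_into (cyc_larcs N C) t (Suc c)))"
    by (rule sum.reindex_bij_witness[of _ Suc "\<lambda>s. s - 1"]) auto
  also have "\<dots> = (\<Sum>c<order_D N. D_mat N T C xi t $$ (r, c) * x (inv_into (cyc_larcs N C) t (Suc c)))"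
    using assms by (intro sum.cong) (auto simp: D_mat_def Let_def)
  finally show ?thesis .
qed

lemma rows_iff_solved:
  assumes Dinv: "Dinv \<in> carrier_mat (order_D N) (order_D N)"
    "inverts_mat (D_mat N T C xi t) Dinv" "inverts_mat Dinv (D_mat N T C xi t)"
  shows "(\<forall>l\<in>{1..order_D N}. (\<Sum>e\<in>cyc_larcs N C. row_coeff l e * x e) = b l) \<longleftrightarrow>
    (\<forall>k\<in>flow_types N. \<forall>e\<in>C k. x e = (\<Sum>s=1..order_D N. Dinv $$ (t e - 1, s - 1) * b s))"
proof -
  let ?n = "order_D N" and ?D = "D_mat N T C xi t" and ?inv = "inv_into (cyc_larcs N C) t"
  have range: "{1..?n} = Suc ` {..<?n}"
    by (simp add: lessThan_atLeast0 image_Suc_atLeastLessThan atLeastLessThanSuc_atLeastAtMost)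
  have D: "?D \<in> carrier_mat ?n ?n" by (simp add: D_mat_def)
  have "(\<forall>l\<in>{1..?n}. (\<Sum>e\<in>cyc_larcs N C. row_coeff l e * x e) = b l) \<longleftrightarrow>
      (\<forall>r<?n. (\<Sum>e\<in>cyc_larcs N C. row_coeff (Suc r) e * x e) = b (Suc r))"
    unfolding range by blast
  also have "\<dots> \<longleftrightarrow> (\<forall>r<?n. (\<Sum>c<?n. ?D $$ (r, c) * x (?inv (Suc c))) = b (Suc r))"
    using sum_cyc_larcs_eq_D_mat_row[of _ x] by auto
  also have "\<dots> \<longleftrightarrow> (\<forall>c<?n. x (?inv (Suc c)) = (\<Sum>r<?n. Dinv $$ (c, r) * b (Suc r)))"
    by (rule inverts_mat_solve_iff[OF D Dinv])
  also have "\<dots> \<longleftrightarrow> (\<forall>l\<in>{1..?n}. x (?inv l) = (\<Sum>r<?n. Dinv $$ (l - 1, r) * b (Suc r)))"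
    unfolding range by auto
  also have "\<dots> \<longleftrightarrow> (\<forall>l\<in>t ` cyc_larcs N C. x (?inv l) = (\<Sum>r<?n. Dinv $$ (l - 1, r) * b (Suc r)))"
    unfolding bij_betw_imp_surj_on[OF bij_t] ..
  also have "\<dots> \<longleftrightarrow> (\<forall>e\<in>cyc_larcs N C. x e = (\<Sum>r<?n. Dinv $$ (t e - 1, r) * b (Suc r)))"
    using bij_betw_imp_inj_on[OF bij_t] by simp
  finally show ?thesis
    unfolding range by (simp add: cyc_larcs_def sum.reindex)
qed

lemma solves_system_iff:
  assumes Dinv: "Dinv \<in> carrier_mat (order_D N) (order_D N)"
    "inverts_mat (D_mat N T C xi t) Dinv" "inverts_mat Dinv (D_mat N T C xi t)"
  shows "solves_system N x \<longleftrightarrow>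
    (\<forall>k\<in>flow_types N. \<forall>e\<in>C k.
      x e = (\<Sum>s=1..order_D N. Dinv $$ (t e - 1, s - 1) * beta N T C xt xi x s)) \<and>
    (\<forall>k\<in>flow_types N. \<forall>f\<in>T k.
      x f = (\<Sum>e\<in>nonbasic N T C k. x e * cycle_sign N T e f)
        + (\<Sum>e\<in>C k. x e * cycle_sign N T e f) + xt f)"
proof -
  let ?exp = "\<forall>k\<in>flow_types N. \<forall>f\<in>larcs N k.
    x f = (\<Sum>e\<in>larcs N k - T k. x e * cycle_sign N T e f) + xt f"
  have balance: "(\<forall>k\<in>flow_types N. balance N k x) \<longleftrightarrow> ?exp"
    by (intro ball_cong refl balance_iff_cycle_expansion) (simp_all add: xt_balance xt_off_tree)
  have "solves_system N x \<longleftrightarrow> ?exp \<and>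
      (\<forall>l\<in>{1..order_D N}. (\<Sum>e\<in>cyc_larcs N C. row_coeff l e * x e) = beta N T C xt xi x l)"
    unfolding solves_system_iff_rows
    \<comment> \<open>The congruence rule makes the expansion available as a hypothesis for the
      rows, which \<open>row_iff\<close> rewrites only for such \<open>x\<close>.\<close>
    by (rule conj_cong[OF balance], rule ball_cong[OF refl], rule row_iff)
  also have "?exp \<longleftrightarrow> (\<forall>k\<in>flow_types N. \<forall>f\<in>T k.
      x f = (\<Sum>e\<in>nonbasic N T C k. x e * cycle_sign N T e f)
        + (\<Sum>e\<in>C k. x e * cycle_sign N T e f) + xt f)"
    by (intro ball_cong refl tree_expansion_iff) (simp_all add: xt_off_tree C_subset)
  finally show ?thesis
    unfolding rows_iff_solved[OF Dinv] by blast
qed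

section \<open>Freedom of the nonbasic variables\<close>

lemma beta_cong:
  assumes "\<And>k e. k \<in> flow_types N \<Longrightarrow> e \<in> nonbasic N T C k \<Longrightarrow> x e = y e"
  shows "beta N T C xt xi x = beta N T C xt xi y"
proof
  have "(\<Sum>k\<in>flow_types N. \<Sum>e\<in>nonbasic N T C k. g e * x e)
      = (\<Sum>k\<in>flow_types N. \<Sum>e\<in>nonbasic N T C k. g e * y e)" for g :: "'v larc \<Rightarrow> real"
    using assms by (intro sum.cong refl) simp
  then show "beta N T C xt xi x l = beta N T C xt xi y l" for l
    by (simp add: beta_def Let_def)
qed

text \<open>By \<open>beta_cong\<close> the values \<open>y\<close> fix \<open>beta\<close> before
  any other value is known. The variables on \<open>C\<close> follow from \<open>beta\<close>, then
  those on the tree.\<close>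

lemma nonbasic_free:
  assumes Dinv: "Dinv \<in> carrier_mat (order_D N) (order_D N)"
    "inverts_mat (D_mat N T C xi t) Dinv" "inverts_mat Dinv (D_mat N T C xi t)"
  shows "\<exists>!x. x \<in> all_larcs N \<rightarrow>\<^sub>E UNIV \<and> solves_system N x \<and>
    (\<forall>k\<in>flow_types N. \<forall>e\<in>nonbasic N T C k. x e = y e)"
proof -
  \<comment> \<open>On the tree the values of \<open>u\<close> are provisional; \<open>v\<close>
    replaces them.\<close>
  define u where "u e = (if e \<in> cyc_larcs N C
      then \<Sum>s=1..order_D N. Dinv $$ (t e - 1, s - 1) * beta N T C xt xi y s else y e)" for e
  define v where "v e = (if e \<in> T (snd e)
      then (\<Sum>d\<in>nonbasic N T C (snd e). u d * cycle_sign N T d e)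
        + (\<Sum>d\<in>C (snd e). u d * cycle_sign N T d e) + xt e else u e)" for e
  have arc_cases: "e \<in> T k \<or> e \<in> C k \<or> e \<in> nonbasic N T C k" if "e \<in> larcs N k" for k e
    using that by (auto simp: nonbasic_def)
  have label: "snd e = k" "e \<in> all_larcs N"
    if "k \<in> flow_types N" "e \<in> T k \<or> e \<in> C k \<or> e \<in> nonbasic N T C k" for k e
  proof -
    have "e \<in> larcs N k"
      using that tree_subset[OF that(1)] C_subset[OF that(1)] by (auto simp: nonbasic_def)
    then show "snd e = k" "e \<in> all_larcs N"
      using that(1) by (auto simp: larcs_def all_larcs_def)
  qed
  have off: "e \<notin> T k" if "k \<in> flow_types N" "e \<in> C k \<or> e \<in> nonbasic N T C k" for k e
    using that C_subset by (auto simp: nonbasic_def)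
  have u_C: "u e = (\<Sum>s=1..order_D N. Dinv $$ (t e - 1, s - 1) * beta N T C xt xi y s)"
    if "k \<in> flow_types N" "e \<in> C k" for k e
    using that by (auto simp: u_def cyc_larcs_def)
  have u_nonbasic: "u e = y e" if "k \<in> flow_types N" "e \<in> nonbasic N T C k" for k e
  proof -
    \<comment> \<open>An arc carries a single label, so membership in \<open>C j\<close> would force
      \<open>j = k\<close>.\<close>
    have "e \<notin> C j" if "j \<in> flow_types N" for j
      using label(1)[of k e] label(1)[of j e] that \<open>k \<in> _\<close> \<open>e \<in> _\<close> by (auto simp: nonbasic_def)
    then show ?thesis by (auto simp: u_def cyc_larcs_def)
  qed
  \<comment> \<open>With this equivalence, existence and uniqueness both reduce to extending
    \<open>v\<close> from \<open>all_larcs\<close> extensionally.\<close>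
  have agrees: "(solves_system N x \<and> (\<forall>k\<in>flow_types N. \<forall>e\<in>nonbasic N T C k. x e = y e)) \<longleftrightarrow>
      (\<forall>e\<in>all_larcs N. x e = v e)" for x
  proof
    assume x: "solves_system N x \<and> (\<forall>k\<in>flow_types N. \<forall>e\<in>nonbasic N T C k. x e = y e)"
    then have "beta N T C xt xi x = beta N T C xt xi y" by (intro beta_cong) auto
    with x have C: "x e = u e" if "k \<in> flow_types N" "e \<in> C k" for k e
      using that unfolding solves_system_iff[OF Dinv] by (simp add: u_C)
    have nb: "x e = u e" if "k \<in> flow_types N" "e \<in> nonbasic N T C k" for k e
      using that x by (simp add: u_nonbasic)
    show "\<forall>e\<in>all_larcs N. x e = v e"
    proof
      fix e assume "e \<in> all_larcs N"
      then obtain k where k: "k \<in> flow_types N" "e \<in> larcs N k" by (auto simp: all_larcs_def)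
      have e: "snd e = k" using k by (auto simp: larcs_def)
      show "x e = v e"
      proof (cases "e \<in> T k")
        case True
        then have "x e = (\<Sum>d\<in>nonbasic N T C k. x d * cycle_sign N T d e)
            + (\<Sum>d\<in>C k. x d * cycle_sign N T d e) + xt e"
          using x k(1) unfolding solves_system_iff[OF Dinv] by blast
        then show ?thesis using True e C[OF k(1)] nb[OF k(1)] by (simp add: v_def)
      next
        case False
        then have "x e = u e" using arc_cases[OF k(2)] C[OF k(1)] nb[OF k(1)] by blast
        then show ?thesis using False e by (simp add: v_def)
      qed
    qed
  next
    assume x: "\<forall>e\<in>all_larcs N. x e = v e"
    have xu: "x e = u e" if "k \<in> flow_types N" "e \<in> C k \<or> e \<in> nonbasic N T C k" for k e
      using that label[of k e] off[of k e] x by (auto simp: v_def)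
    have nb: "\<forall>k\<in>flow_types N. \<forall>e\<in>nonbasic N T C k. x e = y e"
      using xu u_nonbasic by auto
    then have "beta N T C xt xi x = beta N T C xt xi y" by (intro beta_cong) auto
    moreover have "x f = (\<Sum>e\<in>nonbasic N T C k. x e * cycle_sign N T e f)
        + (\<Sum>e\<in>C k. x e * cycle_sign N T e f) + xt f"
      if "k \<in> flow_types N" "f \<in> T k" for k f
      using that label[of k f] x xu[of k] by (simp add: v_def)
    ultimately have "solves_system N x"
      unfolding solves_system_iff[OF Dinv] using xu u_C by auto
    with nb show "solves_system N x \<and> (\<forall>k\<in>flow_types N. \<forall>e\<in>nonbasic N T C k. x e = y e)" by blast
  qed
  show ?thesis
    unfolding agrees
  proof (rule ex1I)
    show "restrict v (all_larcs N) \<in> all_larcs N \<rightarrow>\<^sub>E UNIV \<and>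
        (\<forall>e\<in>all_larcs N. restrict v (all_larcs N) e = v e)" by simp
    show "x = restrict v (all_larcs N)"
      if "x \<in> all_larcs N \<rightarrow>\<^sub>E UNIV \<and> (\<forall>e\<in>all_larcs N. x e = v e)" for x
      using that by (intro ext) (auto simp: PiE_def extensional_def)
  qed
qed

lemma sum_rows_split:
  "(\<Sum>s=1..order_D N. g s)
    = (\<Sum>p=1..num_side N. g p) + (\<Sum>ij\<in>side_arcs N. g (num_side N + xi ij) :: real)"
proof -
  have "(\<Sum>ij\<in>side_arcs N. g (num_side N + xi ij)) = (\<Sum>s=1..card (side_arcs N). g (num_side N + s))"
    by (rule sum.reindex_bij_betw[OF bij_xi])
  also have "\<dots> = (\<Sum>s=num_side N + 1..num_side N + card (side_arcs N). g s)"
    using sum.shift_bounds_cl_nat_ivl[of g 1 "num_side N" "card (side_arcs N)"]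
    by (simp only: add.commute)
  finally show ?thesis
    using sum.ub_add_nat[of 1 "num_side N" g "card (side_arcs N)"] by (simp only: order_D_def)
qed

end

theorem mainTheorem6:
  fixes N :: "'v flow_data"
    and T C :: "nat \<Rightarrow> 'v larc set"
    and xt :: "'v larc \<Rightarrow> real"
    and xi :: "'v arc \<Rightarrow> nat"
    and t :: "'v larc \<Rightarrow> nat"
    and Dinv :: "real mat"
    and \<nu> :: "nat \<Rightarrow> nat \<Rightarrow> real"
  assumes "flow_network N"
    and "\<And>k. k \<in> flow_types N \<Longrightarrow>
           und_spanning_tree (type_graph N k (T k)) (type_graph N k (larcs N k))"
    and "\<And>k. k \<in> flow_types N \<Longrightarrow> balance N k xt"
    and "\<And>k e. k \<in> flow_types N \<Longrightarrow> e \<in> larcs N k - T k \<Longrightarrow> xt e = 0"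
    and "\<And>k. k \<in> flow_types N \<Longrightarrow> C k \<subseteq> larcs N k - T k"
    and "(\<Sum>k\<in>flow_types N. card (C k)) = num_side N + card (side_arcs N)"
    and "bij_betw xi (side_arcs N) {1..card (side_arcs N)}"
    and "bij_betw t (cyc_larcs N C) {1..num_side N + card (side_arcs N)}"
    and "det (D_mat N T C xi t) \<noteq> 0"
    and "Dinv \<in> carrier_mat (order_D N) (order_D N)"
    and "inverts_mat (D_mat N T C xi t) Dinv"
    and "inverts_mat Dinv (D_mat N T C xi t)"
    and "\<And>l s. l \<in> {1..order_D N} \<Longrightarrow> s \<in> {1..order_D N} \<Longrightarrow> \<nu> l s = Dinv $$ (l - 1, s - 1)"
  shows
    "(\<forall>x :: 'v larc \<Rightarrow> real. solves_system N x \<longleftrightarrow>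
        (\<forall>k\<in>flow_types N. \<forall>e\<in>C k.
           x e = (\<Sum>p=1..num_side N. \<nu> (t e) p * beta N T C xt xi x p)
               + (\<Sum>ij\<in>side_arcs N. \<nu> (t e) (num_side N + xi ij)
                    * beta N T C xt xi x (num_side N + xi ij))) \<and>
        (\<forall>k\<in>flow_types N. \<forall>f\<in>T k.
           x f = (\<Sum>e\<in>nonbasic N T C k. x e * cycle_sign N T e f)
               + (\<Sum>e\<in>C k. x e * cycle_sign N T e f) + xt f)) \<and>
     (\<forall>y :: 'v larc \<Rightarrow> real.
        \<exists>!x. x \<in> all_larcs N \<rightarrow>\<^sub>E UNIV \<and> solves_system N x \<and>
             (\<forall>k\<in>flow_types N. \<forall>e\<in>nonbasic N T C k. x e = y e))"
proof -
  interpret cyclic_basis N T C xt xi t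
    by unfold_locales (use assms in \<open>simp_all add: order_D_def\<close>)
  have "(\<Sum>s=1..order_D N. Dinv $$ (t e - 1, s - 1) * b s)
      = (\<Sum>p=1..num_side N. \<nu> (t e) p * b p)
        + (\<Sum>ij\<in>side_arcs N. \<nu> (t e) (num_side N + xi ij) * b (num_side N + xi ij))"
    if "k \<in> flow_types N" "e \<in> C k" for k e b
  proof -
    \<comment> \<open>\<open>\<nu>\<close> is tied to \<open>Dinv\<close> only for indices in this
      range.\<close>
    have "t e \<in> {1..order_D N}"
      using that by (intro bij_betw_apply[OF bij_t]) (auto simp: cyc_larcs_def)
    then show ?thesis
      unfolding sum_rows_split[of "\<lambda>s. \<nu> (t e) s * b s", symmetric] using assms(13) by (intro sum.cong) auto
  qed
  then show ?thesis
    using nonbasic_free[OF assms(10-12)] by (simp add: solves_system_iff[OF assms(10-12)])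
qed

end
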